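(* Let $(X,d)$ be a metric space, let $f_n:X\to X$, $n\ge0$, be maps, let $A=(a_{ij})_{N\times N}$ be a transition matrix, and let $V_i$, $1\le i\le N$, be nonempty subsets of $X$ with $d(V_i,V_j)>0$ for all $1\le i\neq j\le N$. Assume that there exist nonempty compact subsets $V_{i,n}$ of $X$ with $V_{i,n}\subset V_i$, $1\le i\le N$, $n\ge0$, such that $\{f_n\}_{n=0}^\infty$ is equi-continuous in $E:=\bigcup_{n=0}^{\infty}\bigcup_{i=1}^{N}V_{i,n}$ and the system $x_{n+1}=f_n(x_n)$ is weakly $A$-coupled-expanding in $\{V_{i,n}\}_{n=0}^\infty$, $1\le i\le N$. Then for every $n\ge0$ there exists a nonempty compact subset $\Lambda_n\subset\bigcup_{i=1}^N V_{i,n}$ with $f_n(\Lambda_n)=\Lambda_{n+1}$ such that the invariant subsystem of $x_{n+1}=f_n(x_n)$ on $\{\Lambda_n\}_{n=0}^\infty$ is topologically equi-semiconjugate to $(\Sigma_N^+(A),\sigma_A)$. Consequently, if $(X,d)$ is compact, then $h(f_{0,\infty},\Lambda_0)\ge\log\rho(A)$.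
   Context: $f_{0,\infty}:=\{f_n\}_{n=0}^\infty$. Notation: $f_i^n:=f_{i+n-1}\circ\cdots\circ f_i$ for $n\ge1$, $f_i^0$ is the identity, and $f_i^{-n}:=(f_i^n)^{-1}$ (preimage). $d(B,C):=\inf\{d(b,c):b\in B,c\in C\}$; $\partial B$ is the boundary of $B$. A sequence of maps $h_n:\Lambda_n\to Y$ into a metric space $(Y,e)$ is equi-continuous in $\{\Lambda_n\}_{n=0}^\infty$ if for every $\epsilon>0$ there is $\delta>0$ such that $e(h_n(x),h_n(y))<\epsilon$ for all $n\ge0$ and all $x,y\in\Lambda_n$ with $d(x,y)<\delta$; "equi-continuous in $E$" means this with $\Lambda_n=E$ for all $n$. A transition matrix is a matrix $A=(a_{ij})_{N\times N}$, $N\ge2$, with $a_{ij}\in\{0,1\}$, $\sum_{j=1}^N a_{ij}\ge1$ for all $i$ and $\sum_{i=1}^N a_{ij}\ge1$ for all $j$. The system $x_{n+1}=f_n(x_n)$ is weakly $A$-coupled-expanding in sequences $\{V_{i,n}\}_{n=0}^\infty$, $1\le i\le N$, of nonempty subsets of $X$ if $V_{i,n}\cap V_{j,n}=\partial V_{i,n}\cap\partial V_{j,n}$ for all $1\le i\ne j\le N$, $n\ge0$, and $f_n(V_{i,n})\supset\bigcup_{j:\,a_{ij}=1}V_{j,n+1}$ for all $1\le i\le N$, $n\ge0$. $\Sigma_N^+(A):=\{s=(s_0,s_1,\dots):1\le s_j\le N,\ a_{s_js_{j+1}}=1,\ j\ge0\}$, with metric $\hat\rho(\alpha,\beta):=\sum_{i=0}^\infty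 \hat d(a_i,b_i)/2^i$ for $\alpha=(a_0,a_1,\dots)$, $\beta=(b_0,b_1,\dots)$, where $\hat d(a,b)=0$ if $a=b$ and $1$ otherwise. $\sigma_A:\Sigma_N^+(A)\to\Sigma_N^+(A)$, $\sigma_A((s_0,s_1,s_2,\dots)):=(s_1,s_2,\dots)$. $\rho(A):=\lim_{n\to\infty}\|A^n\|^{1/n}$, where $\|B\|$ denotes the sum of all entries of $B$. For subsets $\Lambda_n\subset X$ with $f_n(\Lambda_n)\subset\Lambda_{n+1}$ for all $n\ge0$, the system restricted to $\{\Lambda_n\}$ is called the invariant subsystem on $\{\Lambda_n\}_{n=0}^\infty$. It is topologically equi-semiconjugate to $(\Sigma_N^+(A),\sigma_A)$ if there are surjective maps $h_n:\Lambda_n\to\Sigma_N^+(A)$, $n\ge0$, with $\{h_n\}$ equi-continuous in $\{\Lambda_n\}$, such that $h_{n+1}\circ f_n=\sigma_A\circ h_n$ on $\Lambda_n$ for all $n\ge0$. Topological entropy: for compact $X$ and nonempty $Y\subset X$, $h(f_{0,\infty},Y):=\sup_{\mathcal A}\limsup_{n\to\infty}\frac1n\log\mathcal N(\mathcal A_0^n|_Y)$, the supremum over open covers $\mathcal A$ of $X$, where $\mathcal A_0^n:=\{\bigcap_{j=0}^{n-1}f_0^{-j}(A_j):A_j\in\mathcal A\}$, $\mathcal B|_Y:=\{B\cap Y:B\in\mathcal B\}$, and $\mathcal N(\cdot)$ is the minimal cardinality of a subcover. *)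

theory Defs
  imports "HOL-Analysis.Analysis"
begin

text \<open>
  The metric space \<open>X\<close> is a type of class \<open>metric_space\<close>, and the symbols \<open>1, \<dots>, N\<close> are the elements
  of a finite type \<open>'n\<close> with \<open>N = CARD('n)\<close>.
\<close>

primrec iter_comp :: "(nat \<Rightarrow> 'a \<Rightarrow> 'a) \<Rightarrow> nat \<Rightarrow> nat \<Rightarrow> 'a \<Rightarrow> 'a" where
  "iter_comp f i 0 = id"
| "iter_comp f i (Suc n) = f (i + n) \<circ> iter_comp f i n"

text \<open>
  The target metric \<open>e\<close> is an explicit argument because the sequence space below carries
  a metric of its own and is not a type.
\<close>

definition equi_continuous_in ::
  "('b \<Rightarrow> 'b \<Rightarrow> real) \<Rightarrow> (nat \<Rightarrow> 'a::metric_space \<Rightarrow> 'b) \<Rightarrow> (nat \<Rightarrow> 'a set) \<Rightarrow> bool" where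
  "equi_continuous_in e h \<Lambda> \<longleftrightarrow>
     (\<forall>\<epsilon>>0. \<exists>\<delta>>0. \<forall>n. \<forall>x\<in>\<Lambda> n. \<forall>y\<in>\<Lambda> n. dist x y < \<delta> \<longrightarrow> e (h n x) (h n y) < \<epsilon>)"

definition transition_matrix :: "real^'n^'n \<Rightarrow> bool" where
  "transition_matrix A \<longleftrightarrow>
     CARD('n) \<ge> 2 \<and>
     (\<forall>i j. A $ i $ j \<in> {0, 1}) \<and>
     (\<forall>i. (\<Sum>j\<in>UNIV. A $ i $ j) \<ge> 1) \<and>
     (\<forall>j. (\<Sum>i\<in>UNIV. A $ i $ j) \<ge> 1)"

definition weakly_coupled_expanding ::
  "real^'n^'n \<Rightarrow> (nat \<Rightarrow> 'a::metric_space \<Rightarrow> 'a) \<Rightarrow> ('n \<Rightarrow> nat \<Rightarrow> 'a set) \<Rightarrow> bool" where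
  "weakly_coupled_expanding A f V \<longleftrightarrow>
     (\<forall>i n. V i n \<noteq> {}) \<and>
     (\<forall>i j n. i \<noteq> j \<longrightarrow> V i n \<inter> V j n = frontier (V i n) \<inter> frontier (V j n)) \<and>
     (\<forall>i n. (\<Union>j\<in>{j. A $ i $ j = 1}. V j (Suc n)) \<subseteq> f n ` V i n)"

definition seq_space :: "real^'n^'n \<Rightarrow> (nat \<Rightarrow> 'n) set" where
  "seq_space A = {s. \<forall>j. A $ (s j) $ (s (Suc j)) = 1}"

definition seq_dist :: "(nat \<Rightarrow> 'n) \<Rightarrow> (nat \<Rightarrow> 'n) \<Rightarrow> real" where
  "seq_dist \<alpha> \<beta> = (\<Sum>i. (if \<alpha> i = \<beta> i then 0 else 1) / 2 ^ i)"

definition shift :: "(nat \<Rightarrow> 'n) \<Rightarrow> nat \<Rightarrow> 'n" where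
  "shift s = (\<lambda>j. s (Suc j))"

definition matrix_power :: "real^'n^'n \<Rightarrow> nat \<Rightarrow> real^'n^'n" where
  "matrix_power A n = (((**) A) ^^ n) (mat 1)"

definition entry_sum :: "real^'n^'n \<Rightarrow> real" where
  "entry_sum B = (\<Sum>i\<in>UNIV. \<Sum>j\<in>UNIV. B $ i $ j)"

definition growth_rate :: "real^'n^'n \<Rightarrow> real" where
  "growth_rate A = lim (\<lambda>n. entry_sum (matrix_power A n) powr (1 / real n))"

definition invariant_sets :: "(nat \<Rightarrow> 'a \<Rightarrow> 'a) \<Rightarrow> (nat \<Rightarrow> 'a set) \<Rightarrow> bool" where
  "invariant_sets f \<Lambda> \<longleftrightarrow> (\<forall>n. f n ` \<Lambda> n \<subseteq> \<Lambda> (Suc n))"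

definition equi_semiconjugate_to_shift ::
  "(nat \<Rightarrow> 'a::metric_space \<Rightarrow> 'a) \<Rightarrow> (nat \<Rightarrow> 'a set) \<Rightarrow> real^'n^'n \<Rightarrow> bool" where
  "equi_semiconjugate_to_shift f \<Lambda> A \<longleftrightarrow>
     invariant_sets f \<Lambda> \<and>
     (\<exists>h. (\<forall>n. h n ` \<Lambda> n = seq_space A) \<and>
          equi_continuous_in seq_dist h \<Lambda> \<and>
          (\<forall>n. \<forall>x\<in>\<Lambda> n. h (Suc n) (f n x) = shift (h n x)))"

definition cover_join :: "(nat \<Rightarrow> 'a \<Rightarrow> 'a) \<Rightarrow> 'a set set \<Rightarrow> nat \<Rightarrow> 'a set set" where
  "cover_join f \<A> n = {\<Inter>j<n. iter_comp f 0 j -` U j |U. \<forall>j<n. U j \<in> \<A>}"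

definition restrict_cover :: "'a set set \<Rightarrow> 'a set \<Rightarrow> 'a set set" where
  "restrict_cover \<B> Y = (\<lambda>B. B \<inter> Y) ` \<B>"

text \<open>
  The number below is meaningful only if \<open>\<C>\<close> has a finite subfamily covering \<open>Y\<close>. For the covers
  used in the entropy this follows from compactness of \<open>X\<close>, without continuity of the maps: a finite
  subcover of \<open>\<A>\<close> has a finite join, which is a subfamily of the join of \<open>\<A>\<close>.
\<close>

definition min_subcover_card :: "'a set set \<Rightarrow> 'a set \<Rightarrow> nat" where
  "min_subcover_card \<C> Y = (LEAST k. \<exists>\<D>\<subseteq>\<C>. finite \<D> \<and> card \<D> = k \<and> Y \<subseteq> \<Union>\<D>)"

text \<open>Extended-real valued, since the supremum may be infinite; intended for compact \<open>X\<close>.\<close>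

definition top_entropy :: "(nat \<Rightarrow> 'a::topological_space \<Rightarrow> 'a) \<Rightarrow> 'a set \<Rightarrow> ereal" where
  "top_entropy f Y =
     (SUP \<A>\<in>{\<A>. (\<forall>U\<in>\<A>. open U) \<and> \<Union>\<A> = UNIV}.
        limsup (\<lambda>n. ereal (1 / real n *
          ln (real (min_subcover_card (restrict_cover (cover_join f \<A> n) Y) Y)))))"

end

theory Submission
  imports Defs
begin

text \<open>
  The sets \<open>W i n\<close> for distinct symbols are uniformly separated, so an orbit that stays in their
  union has at most one itinerary. Expansion makes every finite cylinder along an admissible sequence
  nonempty, and compactness makes every admissible sequence an itinerary; the points with admissible
  itinerary form \<open>\<Lambda> n\<close>, and the itinerary is the semiconjugacy. For a fixed length there are only
  finitely many cylinders, which makes \<open>\<Lambda> n\<close> closed. Points that are close under the first \<open>m\<close> iterates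
  share their first \<open>m\<close> symbols; this gives both equi-continuity and, for a cover by small balls, at
  least as many members in a subcover of the join as there are admissible words. These are counted by the
  powers of \<open>A\<close>, whose growth rate exists by Fekete's lemma.
\<close>

section \<open>Subadditive sequences\<close>

text \<open>Division with remainder by a fixed \<open>m\<close> compares \<open>u n / n\<close> with
  \<open>u m / m\<close> up to an error of order \<open>1 / n\<close>, so the quotients converge to
  their infimum, which nonnegativity bounds below.\<close>

lemma fekete_nonneg:
  fixes u :: "nat \<Rightarrow> real"
  assumes nonneg: "\<And>n. u n \<ge> 0"
    and subadd: "\<And>m n. u (m + n) \<le> u m + u n"
  shows "convergent (\<lambda>n. u n / real n)"
proof -
  \<comment> \<open>The index 0 is left out because \<open>u 0 / 0\<close> is 0 by convention and
    would force the infimum to be 0.\<close>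
  define L where "L = (INF n\<in>{1..}. u n / real n)"
  have bdd: "bdd_below ((\<lambda>n. u n / real n) ` {1..})"
    by (rule bdd_belowI2[where m = 0]) (simp add: nonneg)
  have lower: "L \<le> u n / real n" if "n \<ge> 1" for n
    unfolding L_def using that by (intro cINF_lower[OF bdd]) auto
  have mult: "u (q * m) \<le> u 0 + real q * u m" for q m
  proof (induction q)
    case (Suc q)
    have "u (Suc q * m) \<le> u m + u (q * m)"
      using subadd[of m "q * m"] by simp
    then show ?case using Suc by (simp add: algebra_simps)
  qed simp
  have "(\<lambda>n. u n / real n) \<longlonglongrightarrow> L"
  proof (rule LIMSEQ_I)
    fix e :: real assume "e > 0"
    then have "(INF n\<in>{1..}. u n / real n) < L + e / 2" by (simp add: L_def)
    then obtain m where m: "m \<ge> 1" "u m / real m < L + e / 2"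
      by (subst (asm) cINF_less_iff[OF _ bdd]) auto
    \<comment> \<open>The two uses of \<open>mult\<close>, for the multiple of \<open>m\<close> and
      for the remainder, cost \<open>u 0\<close> each; the remainder is below \<open>m\<close> and
      adds at most \<open>m\<close> times \<open>u 1\<close>.\<close>
    define C where "C = 2 * u 0 + real m * u 1"
    have C: "C \<ge> 0" by (simp add: C_def nonneg)
    have upper: "u n / real n \<le> u m / real m + C / real n" if "n \<ge> 1" for n
    proof -
      have "u n \<le> u (n div m * m) + u (n mod m)"
        using subadd[of "n div m * m" "n mod m"] by simp
      also have "u (n div m * m) \<le> u 0 + real (n div m) * u m" by (rule mult)
      also have "real (n div m) * u m \<le> real n / real m * u m"
        by (intro mult_right_mono nonneg of_nat_div_le_of_nat)
      also have "u (n mod m) \<le> u 0 + real (n mod m) * u 1" using mult[of "n mod m" 1] by simp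
      also have "real (n mod m) * u 1 \<le> real m * u 1"
        using m by (intro mult_right_mono nonneg) simp
      finally have "u n \<le> real n * (u m / real m) + C" by (simp add: C_def)
      then have "u n / real n \<le> (real n * (u m / real m) + C) / real n"
        by (rule divide_right_mono) simp
      then show ?thesis using that by (simp add: add_divide_distrib)
    qed
    obtain M :: nat where M: "2 * C / e < real M" using reals_Archimedean2 by blast
    show "\<exists>n0. \<forall>n\<ge>n0. norm (u n / real n - L) < e"
    proof (intro exI allI impI)
      fix n assume n: "n \<ge> Suc M"
      have "2 * C / e < real n" using M n by linarith
      then have "C / real n < e / 2"
        using n \<open>e > 0\<close> by (simp add: field_simps)
      then have "u n / real n - L < e"
        using upper[of n] m n by linarith
      then show "norm (u n / real n - L) < e"
        using lower[of n] n by simp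
    qed
  qed
  then show ?thesis by (rule convergentI)
qed

subsection \<open>Transition matrices and admissible words\<close>

lemma matrix_power_0 [simp]: "matrix_power A 0 = mat 1"
  by (simp add: matrix_power_def)

lemma matrix_power_Suc [simp]: "matrix_power A (Suc n) = A ** matrix_power A n"
  by (simp add: matrix_power_def)

lemma matrix_power_add: "matrix_power A (m + n) = matrix_power A m ** matrix_power A n"
  by (induction m) (simp_all add: matrix_mul_assoc)

lemma matrix_power_nonneg:
  assumes "\<And>i j. A $ i $ j \<ge> 0"
  shows "matrix_power A n $ i $ j \<ge> 0"
proof (induction n arbitrary: i j)
  case (Suc n)
  then show ?case
    by (auto simp: matrix_matrix_mult_def intro!: sum_nonneg mult_nonneg_nonneg assms)
qed (simp add: mat_def)

text \<open>Each row sum of the nonnegative matrix \<open>C\<close> is at most its total. Applied to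
  powers of \<open>A\<close>, this is the subadditivity of the logarithms.\<close>

lemma entry_sum_mult_le:
  fixes B C :: "real^'n^'n"
  assumes B: "\<And>i j. B $ i $ j \<ge> 0" and C: "\<And>i j. C $ i $ j \<ge> 0"
  shows "entry_sum (B ** C) \<le> entry_sum B * entry_sum C"
proof -
  have "entry_sum (B ** C) = (\<Sum>i\<in>UNIV. \<Sum>j\<in>UNIV. \<Sum>k\<in>UNIV. B $ i $ k * C $ k $ j)"
    by (simp add: entry_sum_def matrix_matrix_mult_def)
  also have "\<dots> = (\<Sum>i\<in>UNIV. \<Sum>k\<in>UNIV. B $ i $ k * (\<Sum>j\<in>UNIV. C $ k $ j))"
    by (subst sum.swap) (simp add: sum_distrib_left)
  also have "\<dots> \<le> (\<Sum>i\<in>UNIV. \<Sum>k\<in>UNIV. B $ i $ k * entry_sum C)"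
    unfolding entry_sum_def
    by (intro sum_mono mult_left_mono B member_le_sum[where f = "\<lambda>k. \<Sum>j\<in>UNIV. C $ k $ j"])
       (auto intro!: sum_nonneg C)
  also have "\<dots> = entry_sum B * entry_sum C"
    by (simp add: entry_sum_def sum_distrib_right)
  finally show ?thesis .
qed

text \<open>Words are taken as prefixes of infinite sequences, which matches the prefixes of
  itineraries. For a transition matrix no finite word is lost, since every symbol has a
  successor.\<close>

definition admissible_words :: "real^'n^'n \<Rightarrow> nat \<Rightarrow> 'n list set" where
  "admissible_words A n = (\<lambda>s. map s [0..<n]) ` seq_space A"

lemma shift_in_seq_space: "s \<in> seq_space A \<Longrightarrow> shift s \<in> seq_space A"
  by (simp add: seq_space_def shift_def)

lemma case_nat_in_seq_space:
  "s \<in> seq_space A \<Longrightarrow> A $ i $ s 0 = 1 \<Longrightarrow> case_nat i s \<in> seq_space A"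
  by (auto simp: seq_space_def split: nat.split)

lemma finite_admissible_words: "finite (admissible_words (A :: real^'n^'n) n)"
proof (rule finite_subset)
  show "admissible_words A n \<subseteq> {xs. set xs \<subseteq> UNIV \<and> length xs = n}"
    by (auto simp: admissible_words_def)
qed (rule finite_lists_length_eq, simp)

locale transition =
  fixes A :: "real^'n^'n"
  assumes transition: "transition_matrix A"
begin

lemma entry_cases: "A $ i $ j = 0 \<or> A $ i $ j = 1"
  using transition by (auto simp: transition_matrix_def)

lemma entry_nonneg: "A $ i $ j \<ge> 0"
  using entry_cases[of i j] by auto

lemma ex_successor: "\<exists>j. A $ i $ j = 1"
proof (rule ccontr)
  assume "\<not> ?thesis"
  then have "(\<Sum>j\<in>UNIV. A $ i $ j) = 0"
    using entry_cases by (metis sum.neutral)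
  moreover have "(\<Sum>j\<in>UNIV. A $ i $ j) \<ge> 1" using transition by (simp add: transition_matrix_def)
  ultimately show False by simp
qed

lemma ex_predecessor: "\<exists>i. A $ i $ j = 1"
proof (rule ccontr)
  assume "\<not> ?thesis"
  then have "(\<Sum>i\<in>UNIV. A $ i $ j) = 0"
    using entry_cases by (metis sum.neutral)
  moreover have "(\<Sum>i\<in>UNIV. A $ i $ j) \<ge> 1" using transition by (simp add: transition_matrix_def)
  ultimately show False by simp
qed

lemma ex_seq_from: "\<exists>s\<in>seq_space A. s 0 = i"
proof -
  obtain g where g: "\<And>i. A $ i $ g i = 1" using ex_successor by metis
  have "(\<lambda>k. (g ^^ k) i) \<in> seq_space A" by (simp add: seq_space_def g)
  then show ?thesis by (intro bexI) auto
qed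

text \<open>A word of \<open>n + 1\<close> symbols makes \<open>n\<close> transitions, so this
  length corresponds to the \<open>n\<close>-th power of \<open>A\<close>.\<close>

definition words_from :: "nat \<Rightarrow> 'n \<Rightarrow> 'n list set" where
  "words_from n i = (\<lambda>s. map s [0..<Suc n]) ` {s \<in> seq_space A. s 0 = i}"

lemma words_from_subset: "words_from n i \<subseteq> admissible_words A (Suc n)"
  by (auto simp: words_from_def admissible_words_def simp del: upt_Suc)

lemma finite_words_from: "finite (words_from n i)"
  using words_from_subset finite_admissible_words by (rule finite_subset)

lemma hd_words_from: "w \<in> words_from n i \<Longrightarrow> w \<noteq> [] \<and> hd w = i"
  by (auto simp: words_from_def upt_conv_Cons simp del: upt_Suc)

text \<open>Stripping the first symbol is the shift, and \<open>case_nat\<close> puts it back. This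
  recursion mirrors \<open>A ** matrix_power A n\<close>.\<close>

lemma words_from_Suc: "words_from (Suc n) i = (\<Union>j\<in>{j. A $ i $ j = 1}. (#) i ` words_from n j)"
proof -
  have upt: "map s [0..<Suc (Suc n)] = s 0 # map (shift s) [0..<Suc n]" for s :: "nat \<Rightarrow> 'n"
    by (subst upt_conv_Cons) (simp_all add: shift_def map_Suc_upt[symmetric] del: upt_Suc)
  show ?thesis
  proof (intro equalityI subsetI)
    fix w assume "w \<in> words_from (Suc n) i"
    then obtain s where s: "s \<in> seq_space A" "s 0 = i" "w = map s [0..<Suc (Suc n)]"
      unfolding words_from_def by blast
    then have "A $ i $ (s 1) = 1" by (auto simp: seq_space_def)
    moreover have "map (shift s) [0..<Suc n] \<in> words_from n (s 1)"
      unfolding words_from_def using s(1) by (intro imageI) (simp add: shift_in_seq_space, simp add: shift_def)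
    ultimately show "w \<in> (\<Union>j\<in>{j. A $ i $ j = 1}. (#) i ` words_from n j)"
      unfolding s(3) upt s(2) by blast
  next
    fix w assume "w \<in> (\<Union>j\<in>{j. A $ i $ j = 1}. (#) i ` words_from n j)"
    then obtain s where s: "s \<in> seq_space A" "A $ i $ s 0 = 1" "w = i # map s [0..<Suc n]"
      unfolding words_from_def by blast
    have "shift (case_nat i s) = s" by (simp add: shift_def)
    then have "w = map (case_nat i s) [0..<Suc (Suc n)]" unfolding upt s(3) by simp
    then show "w \<in> words_from (Suc n) i"
      unfolding words_from_def using case_nat_in_seq_space[OF s(1,2)]
      by (intro image_eqI[where x = "case_nat i s"]) simp_all
  qed
qed

text \<open>Words continuing with different second symbols are different, so the counts add up over
  the successors of \<open>i\<close>.\<close>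

lemma card_words_from: "real (card (words_from n i)) = (\<Sum>j\<in>UNIV. matrix_power A n $ i $ j)"
proof (induction n arbitrary: i)
  case 0
  have "words_from 0 i = {[i]}" using ex_seq_from[of i] by (auto simp: words_from_def)
  then show ?case by (simp add: mat_def)
next
  case (Suc n)
  have "card (words_from (Suc n) i) = (\<Sum>j\<in>{j. A $ i $ j = 1}. card ((#) i ` words_from n j))"
    unfolding words_from_Suc
  proof (intro card_UN_disjoint ballI impI)
    fix j k :: 'n assume "j \<noteq> k"
    then show "(#) i ` words_from n j \<inter> (#) i ` words_from n k = {}"
      by (auto dest: hd_words_from)
  qed (simp_all add: finite_words_from)
  then have "real (card (words_from (Suc n) i)) =
      (\<Sum>j\<in>{j. A $ i $ j = 1}. \<Sum>k\<in>UNIV. matrix_power A n $ j $ k)"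
    by (simp add: card_image Suc)
  \<comment> \<open>As the entries are 0 or 1, they act as the indicator of the successors of
    \<open>i\<close>.\<close>
  also have "\<dots> = (\<Sum>j\<in>UNIV. A $ i $ j * (\<Sum>k\<in>UNIV. matrix_power A n $ j $ k))"
    using entry_cases by (intro sum.mono_neutral_cong_left) auto
  also have "\<dots> = (\<Sum>k\<in>UNIV. \<Sum>j\<in>UNIV. A $ i $ j * matrix_power A n $ j $ k)"
    by (subst sum.swap) (simp add: sum_distrib_left)
  finally show ?case by (simp add: matrix_matrix_mult_def)
qed

lemma card_admissible_words: "real (card (admissible_words A (Suc n))) = entry_sum (matrix_power A n)"
proof -
  have "admissible_words A (Suc n) = (\<Union>i. words_from n i)"
    by (auto simp: admissible_words_def words_from_def simp del: upt_Suc)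
  moreover have "card (\<Union>i. words_from n i) = (\<Sum>i\<in>UNIV. card (words_from n i))"
  proof (intro card_UN_disjoint ballI impI)
    fix i j :: 'n assume "i \<noteq> j"
    then show "words_from n i \<inter> words_from n j = {}" by (auto dest: hd_words_from)
  qed (simp_all add: finite_words_from)
  ultimately show ?thesis by (simp add: card_words_from entry_sum_def)
qed

lemma entry_sum_ge_1: "entry_sum (matrix_power A n) \<ge> 1"
proof -
  have "admissible_words A (Suc n) \<noteq> {}" using ex_seq_from by (auto simp: admissible_words_def)
  then have "card (admissible_words A (Suc n)) > 0" by (simp add: card_gt_0_iff finite_admissible_words)
  then show ?thesis using card_admissible_words[of n] by linarith
qed

lemma entry_sum_add_le:
  "entry_sum (matrix_power A (m + n)) \<le> entry_sum (matrix_power A m) * entry_sum (matrix_power A n)"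
  unfolding matrix_power_add by (intro entry_sum_mult_le matrix_power_nonneg entry_nonneg)

text \<open>\<open>growth_rate\<close> is a \<open>lim\<close>, which is informative only once
  convergence is known. Fekete's lemma for the logarithms supplies it, and exponentiating identifies
  the limit.\<close>

lemma ln_entry_sum_tendsto:
  "(\<lambda>n. ln (entry_sum (matrix_power A n)) / real n) \<longlonglongrightarrow> ln (growth_rate A)"
proof -
  define u where "u n = ln (entry_sum (matrix_power A n))" for n
  have pos: "entry_sum (matrix_power A n) > 0" for n using entry_sum_ge_1[of n] by linarith
  have "convergent (\<lambda>n. u n / real n)"
  proof (rule fekete_nonneg)
    fix m n
    show "u n \<ge> 0" unfolding u_def using entry_sum_ge_1 by simp
    have "u (m + n) \<le> ln (entry_sum (matrix_power A m) * entry_sum (matrix_power A n))"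
      unfolding u_def using pos entry_sum_add_le by (subst ln_le_cancel_iff) (auto intro!: mult_pos_pos)
    then show "u (m + n) \<le> u m + u n" using pos[of m] pos[of n] by (simp add: u_def ln_mult)
  qed
  then obtain L where L: "(\<lambda>n. u n / real n) \<longlonglongrightarrow> L" unfolding convergent_def by blast
  then have "(\<lambda>n. exp (u n / real n)) \<longlonglongrightarrow> exp L" by (rule tendsto_exp)
  moreover have "exp (u n / real n) = entry_sum (matrix_power A n) powr (1 / real n)" for n
    using pos[of n] by (simp add: powr_def u_def)
  ultimately have "growth_rate A = exp L" unfolding growth_rate_def by (simp add: limI)
  then show ?thesis using L by (simp add: u_def)
qed

text \<open>Words of length \<open>n + 1\<close> are counted by the \<open>n\<close>-th power; the
  factor \<open>n / (n + 1)\<close> absorbs the offset.\<close>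

lemma ln_card_admissible_words_tendsto:
  "(\<lambda>n. ln (real (card (admissible_words A (Suc n)))) / real (Suc n)) \<longlonglongrightarrow> ln (growth_rate A)"
proof -
  have "(\<lambda>n. ln (entry_sum (matrix_power A n)) / real n * (real n / real (Suc n)))
      \<longlonglongrightarrow> ln (growth_rate A) * 1"
    by (intro tendsto_mult ln_entry_sum_tendsto LIMSEQ_n_over_Suc_n)
  then have "(\<lambda>n. ln (entry_sum (matrix_power A n)) / real n * (real n / real (Suc n)))
      \<longlonglongrightarrow> ln (growth_rate A)" by simp
  then show ?thesis
  proof (rule Lim_transform_eventually)
    show "\<forall>\<^sub>F n in sequentially. ln (entry_sum (matrix_power A n)) / real n * (real n / real (Suc n))
        = ln (real (card (admissible_words A (Suc n)))) / real (Suc n)"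
      \<comment> \<open>At \<open>n = 0\<close> the left side is 0 by the division convention and
        the right side is not.\<close>
      using eventually_gt_at_top[of 0]
      by eventually_elim (simp add: card_admissible_words)
  qed
qed

end

subsection \<open>Iterates and coding\<close>

text \<open>The recursion of \<open>iter_comp\<close> splits off the last map; splitting off the
  first one is what corresponds to the shift.\<close>

lemma iter_comp_Suc_left: "iter_comp f n (Suc k) x = iter_comp f (Suc n) k (f n x)"
  by (induction k) simp_all

lemma compact_continuous_preimage:
  assumes "compact S" "continuous_on S f" "closed T"
  shows "compact {x \<in> S. f x \<in> T}"
proof -
  have "{x \<in> S. f x \<in> T} = S \<inter> f -` T" by auto
  then show ?thesis
    using assms by (metis closedin_compact continuous_closedin_preimage)
qed

lemma equi_continuous_in_imp_continuous_on:
  assumes "equi_continuous_in dist f \<Lambda>"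
  shows "continuous_on (\<Lambda> n) (f n)"
  unfolding continuous_on_iff using assms unfolding equi_continuous_in_def
  by (metis dist_commute)

text \<open>Only the tail from index \<open>m\<close> contributes, and it is dominated by a
  geometric series.\<close>

lemma seq_dist_le:
  assumes "\<And>k. k < m \<Longrightarrow> \<alpha> k = \<beta> k"
  shows "seq_dist \<alpha> \<beta> \<le> 2 * (1/2) ^ m"
proof -
  let ?t = "\<lambda>i. (if \<alpha> i = \<beta> i then 0 else 1) / (2::real) ^ i"
  have geo: "(\<lambda>i. (1/2::real) ^ i) sums 2" using geometric_sums[of "1/2::real"] by simp
  have le: "?t i \<le> (1/2) ^ i" for i by (simp add: power_one_over)
  have sum: "summable ?t"
    by (rule summable_comparison_test'[OF sums_summable[OF geo], of 0]) (use le in auto)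
  have "suminf ?t = (\<Sum>i. ?t (i + m)) + (\<Sum>i<m. ?t i)" by (rule suminf_split_initial_segment[OF sum])
  also have "(\<Sum>i<m. ?t i) = 0" using assms by (intro sum.neutral) auto
  also have "(\<Sum>i. ?t (i + m)) \<le> (\<Sum>i. (1/2) ^ i * (1/2) ^ m)"
  proof (rule suminf_le)
    show "?t (i + m) \<le> (1/2) ^ i * (1/2) ^ m" for i using le[of "i + m"] by (simp add: power_add)
    show "summable (\<lambda>i. ?t (i + m))" using summable_ignore_initial_segment[OF sum] .
    show "summable (\<lambda>i. (1/2::real) ^ i * (1/2) ^ m)"
      using sums_summable[OF geo] by (rule summable_mult2)
  qed
  also have "(\<Sum>i. (1/2::real) ^ i * (1/2) ^ m) = 2 * (1/2) ^ m"
    using sums_mult2[OF geo, of "(1/2) ^ m"] by (simp add: sums_iff)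
  finally show ?thesis by (simp add: seq_dist_def)
qed

text \<open>Invariance puts \<open>f n x\<close> into the next set, where the modulus for
  \<open>k\<close> steps applies again because it is uniform in the starting time.\<close>

lemma equi_continuous_in_iterates:
  assumes equi: "equi_continuous_in dist f (\<lambda>_. E)"
    and inv: "\<And>n. f n ` \<Lambda> n \<subseteq> \<Lambda> (Suc n)" and sub: "\<And>n. \<Lambda> n \<subseteq> E"
  shows "equi_continuous_in dist (\<lambda>n. iter_comp f n k) \<Lambda>"
proof (induction k)
  case 0
  show ?case unfolding equi_continuous_in_def by auto
next
  case (Suc k)
  show ?case unfolding equi_continuous_in_def
  proof (intro allI impI)
    fix e :: real assume "e > 0"
    then obtain d where d: "d > 0"
      "\<And>n x y. x \<in> \<Lambda> n \<Longrightarrow> y \<in> \<Lambda> n \<Longrightarrow> dist x y < d \<Longrightarrow> dist (iter_comp f n k x) (iter_comp f n k y) < e"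
      using Suc unfolding equi_continuous_in_def by meson
    obtain d' where d': "d' > 0"
      "\<And>n x y. x \<in> E \<Longrightarrow> y \<in> E \<Longrightarrow> dist x y < d' \<Longrightarrow> dist (f n x) (f n y) < d"
      using equi d(1) unfolding equi_continuous_in_def by meson
    show "\<exists>\<delta>>0. \<forall>n. \<forall>x\<in>\<Lambda> n. \<forall>y\<in>\<Lambda> n. dist x y < \<delta> \<longrightarrow>
        dist (iter_comp f n (Suc k) x) (iter_comp f n (Suc k) y) < e"
    proof (intro exI conjI allI ballI impI)
      fix n x y assume xy: "x \<in> \<Lambda> n" "y \<in> \<Lambda> n" "dist x y < d'"
      then have "dist (f n x) (f n y) < d" using d'(2) sub by blast
      then show "dist (iter_comp f n (Suc k) x) (iter_comp f n (Suc k) y) < e"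
        unfolding iter_comp_Suc_left using xy inv by (intro d(2)) auto
    qed (rule d'(1))
  qed
qed

lemma equi_continuous_in_finite_bound:
  fixes m :: nat
  assumes "\<And>k. equi_continuous_in dist (g k) \<Lambda>" "e > 0"
  shows "\<exists>d>0. \<forall>k<m. \<forall>n. \<forall>x\<in>\<Lambda> n. \<forall>y\<in>\<Lambda> n. dist x y < d \<longrightarrow> dist (g k n x) (g k n y) < (e::real)"
proof (induction m)
  case 0
  show ?case by (auto intro: zero_less_one)
next
  case (Suc m)
  then obtain d where d: "d > 0"
    "\<And>k n x y. k < m \<Longrightarrow> x \<in> \<Lambda> n \<Longrightarrow> y \<in> \<Lambda> n \<Longrightarrow> dist x y < d \<Longrightarrow> dist (g k n x) (g k n y) < e"
    by blast
  obtain d' where d': "d' > 0"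
    "\<And>n x y. x \<in> \<Lambda> n \<Longrightarrow> y \<in> \<Lambda> n \<Longrightarrow> dist x y < d' \<Longrightarrow> dist (g m n x) (g m n y) < e"
    using assms unfolding equi_continuous_in_def by meson
  show ?case
    by (rule exI[of _ "min d d'"]) (use d d' in \<open>auto simp: less_Suc_eq\<close>)
qed

section \<open>Cardinalities of subcovers\<close>

text \<open>The first assumption ensures that the \<open>LEAST\<close> is attained by an actual
  finite subcover.\<close>

lemma min_subcover_card_ge:
  assumes "\<exists>\<D>\<subseteq>\<C>. finite \<D> \<and> Y \<subseteq> \<Union>\<D>"
    and "\<And>\<D>. \<D> \<subseteq> \<C> \<Longrightarrow> finite \<D> \<Longrightarrow> Y \<subseteq> \<Union>\<D> \<Longrightarrow> k \<le> card \<D>"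
  shows "k \<le> min_subcover_card \<C> Y"
proof -
  have "\<exists>\<D>\<subseteq>\<C>. finite \<D> \<and> card \<D> = min_subcover_card \<C> Y \<and> Y \<subseteq> \<Union>\<D>"
    unfolding min_subcover_card_def by (rule LeastI_ex) (use assms(1) in blast)
  then show ?thesis using assms(2) by metis
qed

text \<open>Members of the join may fail to be open, so compactness is applied to \<A> and the
  finite subcover is joined afterwards.\<close>

lemma finite_subcover_cover_join:
  fixes f :: "nat \<Rightarrow> 'a::topological_space \<Rightarrow> 'a"
  assumes "compact (UNIV :: 'a set)" "\<And>U. U \<in> \<A> \<Longrightarrow> open U" "\<Union>\<A> = UNIV"
  shows "\<exists>\<D>\<subseteq>restrict_cover (cover_join f \<A> n) Y. finite \<D> \<and> Y \<subseteq> \<Union>\<D>"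
proof -
  obtain \<B> where \<B>: "\<B> \<subseteq> \<A>" "finite \<B>" "UNIV \<subseteq> \<Union>\<B>"
    using compactE[of UNIV \<A>] assms by auto
  \<comment> \<open>Only the values of \<open>U\<close> below \<open>n\<close> matter, so the
    choices can be cut down to a finite product.\<close>
  have "cover_join f \<B> n \<subseteq> (\<lambda>U. \<Inter>j<n. iter_comp f 0 j -` U j) ` (PiE {..<n} (\<lambda>_. \<B>))"
  proof
    fix B assume "B \<in> cover_join f \<B> n"
    then obtain U where U: "B = (\<Inter>j<n. iter_comp f 0 j -` U j)" "\<forall>j<n. U j \<in> \<B>"
      unfolding cover_join_def by blast
    show "B \<in> (\<lambda>U. \<Inter>j<n. iter_comp f 0 j -` U j) ` (PiE {..<n} (\<lambda>_. \<B>))"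
      by (rule image_eqI[where x = "restrict U {..<n}"]) (use U in auto)
  qed
  then have "finite (cover_join f \<B> n)"
    by (rule finite_subset) (simp add: finite_PiE \<B>)
  then have "finite (restrict_cover (cover_join f \<B> n) Y)" by (simp add: restrict_cover_def)
  moreover have "restrict_cover (cover_join f \<B> n) Y \<subseteq> restrict_cover (cover_join f \<A> n) Y"
    using \<B>(1) unfolding restrict_cover_def cover_join_def by (intro image_mono) blast
  moreover have "Y \<subseteq> \<Union>(restrict_cover (cover_join f \<B> n) Y)"
  proof
    fix x assume "x \<in> Y"
    have "\<forall>j. \<exists>U\<in>\<B>. iter_comp f 0 j x \<in> U" using \<B>(3) by auto
    then obtain U where "\<And>j. U j \<in> \<B> \<and> iter_comp f 0 j x \<in> U j" by metis
    then have "(\<Inter>j<n. iter_comp f 0 j -` U j) \<in> cover_join f \<B> n"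
      "x \<in> (\<Inter>j<n. iter_comp f 0 j -` U j)"
      by (auto simp: cover_join_def)
    then show "x \<in> \<Union>(restrict_cover (cover_join f \<B> n) Y)"
      using \<open>x \<in> Y\<close> unfolding restrict_cover_def by blast
  qed
  ultimately show ?thesis by blast
qed

text \<open>A label constant on each member is determined by one chosen point of that
  member.\<close>

lemma card_image_le_card_cover:
  assumes "finite \<D>" "Y \<subseteq> \<Union>\<D>" "\<And>D x y. D \<in> \<D> \<Longrightarrow> x \<in> D \<Longrightarrow> y \<in> D \<Longrightarrow> c x = c y"
  shows "card (c ` Y) \<le> card \<D>"
proof (rule surj_card_le[OF assms(1)])
  show "c ` Y \<subseteq> (\<lambda>D. c (SOME x. x \<in> D)) ` \<D>"
  proof
    fix w assume "w \<in> c ` Y"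
    then obtain x D where "x \<in> D" "D \<in> \<D>" "w = c x" using assms(2) by blast
    moreover from this have "(SOME x. x \<in> D) \<in> D" by (intro someI)
    ultimately show "w \<in> (\<lambda>D. c (SOME x. x \<in> D)) ` \<D>" using assms(3) by blast
  qed
qed

section \<open>Cylinders, itineraries and the invariant sets\<close>

text \<open>The enclosing sets of the theorem enter only through the distance \<open>r\<close>,
  which separates distinct symbols even at different times \<open>m\<close> and
  \<open>n\<close>.\<close>

locale separated_expanding = transition A
  for A :: "real^'n^'n" +
  fixes f :: "nat \<Rightarrow> 'a::metric_space \<Rightarrow> 'a"
    and W :: "'n \<Rightarrow> nat \<Rightarrow> 'a set"
    and r :: real
  assumes compact_W: "\<And>i n. compact (W i n)"
    and equi: "equi_continuous_in dist f (\<lambda>_. \<Union>n. \<Union>i. W i n)"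
    and expanding: "weakly_coupled_expanding A f W"
    and r_pos: "r > 0"
    and separated: "\<And>i j m n x y. i \<noteq> j \<Longrightarrow> x \<in> W i m \<Longrightarrow> y \<in> W j n \<Longrightarrow> r \<le> dist x y"
begin

lemma W_nonempty: "W i n \<noteq> {}"
  using expanding by (simp add: weakly_coupled_expanding_def)

lemma W_covered: "A $ i $ j = 1 \<Longrightarrow> W j (Suc n) \<subseteq> f n ` W i n"
  using expanding unfolding weakly_coupled_expanding_def by blast

lemma index_unique: "x \<in> W i m \<Longrightarrow> x \<in> W j n \<Longrightarrow> i = j"
  using separated[of i j x m x n] r_pos by fastforce

lemma continuous_on_W: "continuous_on (W i n) (f n)"
  using equi_continuous_in_imp_continuous_on[OF equi] by (rule continuous_on_subset) auto

definition cylinder :: "nat \<Rightarrow> nat \<Rightarrow> (nat \<Rightarrow> 'n) \<Rightarrow> 'a set" where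
  "cylinder m n s = {x. \<forall>k\<le>m. iter_comp f n k x \<in> W (s k) (n + k)}"

lemma cylinder_0: "cylinder 0 n s = W (s 0) n"
  by (simp add: cylinder_def)

lemma cylinder_Suc:
  "cylinder (Suc m) n s = {x \<in> W (s 0) n. f n x \<in> cylinder m (Suc n) (shift s)}"
proof -
  have "(\<forall>k\<le>Suc m. P k) \<longleftrightarrow> P 0 \<and> (\<forall>k\<le>m. P (Suc k))" for P
    by (metis Suc_le_mono le0 not0_implies_Suc)
  then show ?thesis
    by (simp add: cylinder_def iter_comp_Suc_left shift_def del: iter_comp.simps(2))
qed

text \<open>By \<open>cylinder_Suc\<close> a cylinder is the preimage of a shorter one inside a
  compact set on which \<open>f n\<close> is continuous.\<close>

lemma compact_cylinder: "compact (cylinder m n s)"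
proof (induction m arbitrary: n s)
  case (Suc m)
  show ?case unfolding cylinder_Suc
    by (intro compact_continuous_preimage compact_W continuous_on_W compact_imp_closed Suc)
qed (simp add: cylinder_0 compact_W)

text \<open>Only the first \<open>m + 1\<close> symbols of the sequence matter. Hence a union over
  all admissible sequences is a finite union.\<close>

lemma finite_cylinders: "finite (range (cylinder m n))"
proof (induction m arbitrary: n)
  case 0
  have "range (cylinder 0 n) \<subseteq> range (\<lambda>i. W i n)" by (auto simp: cylinder_0)
  then show ?case by (rule finite_subset) simp
next
  case (Suc m)
  have "range (cylinder (Suc m) n) \<subseteq>
      (\<lambda>(i, C). {x \<in> W i n. f n x \<in> C}) ` (UNIV \<times> range (cylinder m (Suc n)))"
    unfolding cylinder_Suc by force
  then show ?case by (rule finite_subset) (simp add: Suc)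
qed

text \<open>A point of the shorter cylinder for the shifted sequence lies in a set covered by the
  image of \<open>W (s 0) n\<close>, so it can be pulled back one step.\<close>

lemma cylinder_nonempty: "s \<in> seq_space A \<Longrightarrow> cylinder m n s \<noteq> {}"
proof (induction m arbitrary: n s)
  case (Suc m)
  then obtain y where y: "y \<in> cylinder m (Suc n) (shift s)"
    using shift_in_seq_space by fastforce
  then have "y \<in> W (shift s 0) (Suc n)" by (auto simp: cylinder_def)
  moreover have "A $ s 0 $ shift s 0 = 1" using Suc.prems by (simp add: seq_space_def shift_def)
  ultimately obtain x where "x \<in> W (s 0) n" "y = f n x" using W_covered by blast
  then show ?case using y unfolding cylinder_Suc by blast
qed (simp add: cylinder_0 W_nonempty)

text \<open>The description is meaningful when the orbit meets some \<open>W i (n + k)\<close> at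
  step \<open>k\<close>; \<open>index_unique\<close> then makes the symbol unique.\<close>

definition code :: "nat \<Rightarrow> 'a \<Rightarrow> nat \<Rightarrow> 'n" where
  "code n x k = (THE i. iter_comp f n k x \<in> W i (n + k))"

lemma code_eq: "iter_comp f n k x \<in> W i (n + k) \<Longrightarrow> code n x k = i"
  unfolding code_def by (rule the_equality) (auto dest: index_unique)

lemma code_eq_cylinder: "x \<in> cylinder m n s \<Longrightarrow> k \<le> m \<Longrightarrow> code n x k = s k"
  by (intro code_eq) (simp add: cylinder_def)

text \<open>In this form compactness is visible. The sequence may depend on the depth
  \<open>m\<close>; \<open>coded_set_iff\<close> shows that the itinerary serves for all depths at
  once.\<close>

definition coded_set :: "nat \<Rightarrow> 'a set" where
  "coded_set n = (\<Inter>m. \<Union>s\<in>seq_space A. cylinder m n s)"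

lemma coded_set_iff:
  "x \<in> coded_set n \<longleftrightarrow> code n x \<in> seq_space A \<and> (\<forall>k. iter_comp f n k x \<in> W (code n x k) (n + k))"
proof
  assume x: "x \<in> coded_set n"
  have "A $ code n x k $ code n x (Suc k) = 1 \<and> iter_comp f n k x \<in> W (code n x k) (n + k)" for k
  proof -
    \<comment> \<open>Depth \<open>Suc k\<close> reaches both symbols of the transition from
      \<open>k\<close> to \<open>Suc k\<close>.\<close>
    obtain s where s: "s \<in> seq_space A" "x \<in> cylinder (Suc k) n s"
      using x by (auto simp: coded_set_def)
    then show ?thesis
      by (auto simp: code_eq_cylinder[OF s(2)] seq_space_def cylinder_def)
  qed
  then show "code n x \<in> seq_space A \<and> (\<forall>k. iter_comp f n k x \<in> W (code n x k) (n + k))"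
    by (simp add: seq_space_def)
qed (auto simp: coded_set_def cylinder_def)

lemma coded_setI:
  assumes "s \<in> seq_space A" "\<And>k. iter_comp f n k x \<in> W (s k) (n + k)"
  shows "x \<in> coded_set n" "code n x = s"
proof -
  show "code n x = s" using assms(2) by (auto intro: code_eq)
  then show "x \<in> coded_set n" using assms by (simp add: coded_set_iff)
qed

lemma compact_coded_set: "compact (coded_set n)"
proof -
  have "compact (\<Union>s\<in>seq_space A. cylinder m n s)" for m
  proof (rule compact_Union)
    show "finite (cylinder m n ` seq_space A)"
      using finite_cylinders by (rule finite_subset[rotated]) auto
  qed (auto intro: compact_cylinder)
  note C = this
  have "coded_set n = (\<Union>s\<in>seq_space A. cylinder 0 n s) \<inter> coded_set n"
    unfolding coded_set_def by blast
  moreover have "closed (coded_set n)"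
    unfolding coded_set_def by (intro closed_INT ballI compact_imp_closed C)
  ultimately show ?thesis using C compact_Int_closed by metis
qed

lemma coded_set_subset: "coded_set n \<subseteq> (\<Union>i. W i n)"
proof
  fix x assume "x \<in> coded_set n"
  then have "iter_comp f n 0 x \<in> W (code n x 0) (n + 0)" unfolding coded_set_iff by blast
  then show "x \<in> (\<Union>i. W i n)" by auto
qed

text \<open>The cylinders along a fixed admissible sequence are nested, nonempty and compact, so
  they share a point, whose itinerary is that sequence.\<close>

lemma code_onto: "code n ` coded_set n = seq_space A"
proof (intro equalityI subsetI)
  fix s assume s: "s \<in> seq_space A"
  have "cylinder 0 n s \<inter> (\<Inter>m\<in>UNIV. cylinder m n s) \<noteq> {}"
  proof (rule compact_imp_fip_image)
    fix I :: "nat set" assume "finite I"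
    \<comment> \<open>The deepest cylinder lies in all the others; inserting 0 also covers an empty
      \<open>I\<close>.\<close>
    then have "cylinder (Max (insert 0 I)) n s \<subseteq> cylinder 0 n s \<inter> (\<Inter>m\<in>I. cylinder m n s)"
      by (auto simp: cylinder_def)
         (meson Max_ge dual_order.trans finite_insert insertCI)
    then show "cylinder 0 n s \<inter> (\<Inter>m\<in>I. cylinder m n s) \<noteq> {}"
      using cylinder_nonempty[OF s] by blast
  qed (auto intro: compact_cylinder compact_imp_closed)
  then obtain x where "\<And>m. x \<in> cylinder m n s" by blast
  then have "iter_comp f n k x \<in> W (s k) (n + k)" for k
    by (auto simp: cylinder_def)
  then show "s \<in> code n ` coded_set n" using coded_setI[OF s] by blast
qed (auto simp: coded_set_iff)

lemma coded_set_nonempty: "coded_set n \<noteq> {}"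
  using code_onto[of n] ex_seq_from by auto

text \<open>Both sides unfold to the same definite description, so the identity holds at every point
  \<open>x\<close>.\<close>

lemma code_step: "code (Suc n) (f n x) = shift (code n x)"
  by (simp add: code_def shift_def iter_comp_Suc_left[symmetric] fun_eq_iff del: iter_comp.simps)

text \<open>For surjectivity the itinerary of \<open>y\<close> is extended to the left: the column
  condition on \<open>A\<close> yields a predecessor \<open>i\<close> of its first symbol, and
  expansion a preimage of \<open>y\<close> in \<open>W i n\<close>.\<close>

lemma image_coded_set: "f n ` coded_set n = coded_set (Suc n)"
proof (intro equalityI subsetI)
  fix y assume "y \<in> f n ` coded_set n"
  then obtain x where x: "x \<in> coded_set n" "y = f n x" by blast
  have "iter_comp f (Suc n) k y \<in> W (shift (code n x) k) (Suc n + k)" for k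
    using x unfolding coded_set_iff x(2) iter_comp_Suc_left[symmetric]
    by (simp add: shift_def del: iter_comp.simps) (metis add_Suc_right)
  moreover have "shift (code n x) \<in> seq_space A"
    using x(1) by (intro shift_in_seq_space) (simp add: coded_set_iff)
  ultimately show "y \<in> coded_set (Suc n)" by (intro coded_setI(1))
next
  fix y assume y: "y \<in> coded_set (Suc n)"
  define s where "s = code (Suc n) y"
  have s: "s \<in> seq_space A" "\<And>k. iter_comp f (Suc n) k y \<in> W (s k) (Suc n + k)"
    using y by (auto simp: coded_set_iff s_def)
  obtain i where i: "A $ i $ s 0 = 1" using ex_predecessor by blast
  have "y \<in> W (s 0) (Suc n)" using s(2)[of 0] by simp
  then obtain x where x: "x \<in> W i n" "y = f n x" using W_covered[OF i] by blast
  have "iter_comp f n k x \<in> W (case_nat i s k) (n + k)" for k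
  proof (cases k)
    case (Suc l)
    then show ?thesis using s(2)[of l] by (simp add: iter_comp_Suc_left x(2) del: iter_comp.simps)
  qed (simp add: x)
  then have "x \<in> coded_set n" using case_nat_in_seq_space[OF s(1) i] by (rule coded_setI(1)[rotated])
  then show "y \<in> f n ` coded_set n" using x(2) by blast
qed

lemma code_eq_if_close:
  assumes "x \<in> coded_set n" "y \<in> coded_set n" "dist (iter_comp f n k x) (iter_comp f n k y) < r"
  shows "code n x k = code n y k"
  using assms separated[of "code n x k" "code n y k"] unfolding coded_set_iff by fastforce

lemma equi_continuous_code: "equi_continuous_in seq_dist code coded_set"
  unfolding equi_continuous_in_def
proof (intro allI impI)
  fix e :: real assume "e > 0"
  \<comment> \<open>Agreement on \<open>m\<close> symbols bounds the distance by
    \<open>2 * (1/2) ^ m\<close>, hence the target \<open>e / 2\<close>.\<close>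
  obtain m where "(1/2::real) ^ m < e / 2"
    using real_arch_pow_inv[of "e / 2" "1/2"] \<open>e > 0\<close> by auto
  then have m: "2 * (1/2) ^ m < e" by simp
  have "equi_continuous_in dist (\<lambda>n. iter_comp f n k) coded_set" for k
  proof (rule equi_continuous_in_iterates[OF equi])
    show "coded_set n \<subseteq> (\<Union>n. \<Union>i. W i n)" for n using coded_set_subset[of n] by blast
  qed (simp add: image_coded_set)
  from equi_continuous_in_finite_bound[OF this r_pos, of m]
  obtain d where d: "d > 0" "\<forall>k<m. \<forall>n. \<forall>x\<in>coded_set n. \<forall>y\<in>coded_set n.
      dist x y < d \<longrightarrow> dist (iter_comp f n k x) (iter_comp f n k y) < r"
    by meson
  show "\<exists>\<delta>>0. \<forall>n. \<forall>x\<in>coded_set n. \<forall>y\<in>coded_set n. dist x y < \<delta> \<longrightarrow> seq_dist (code n x) (code n y) < e"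
  proof (intro exI conjI allI ballI impI)
    fix n x y assume xy: "x \<in> coded_set n" "y \<in> coded_set n" "dist x y < d"
    have "seq_dist (code n x) (code n y) \<le> 2 * (1/2) ^ m"
      using d(2) xy by (intro seq_dist_le code_eq_if_close) auto
    then show "seq_dist (code n x) (code n y) < e" using m by linarith
  qed (rule d(1))
qed

lemma equi_semiconjugate_coded_set: "equi_semiconjugate_to_shift f coded_set A"
  unfolding equi_semiconjugate_to_shift_def invariant_sets_def
  by (intro conjI allI exI[where x = code])
     (simp_all add: image_coded_set code_onto equi_continuous_code code_step)

text \<open>In the join of the cover by balls of radius \<open>r / 2\<close>, each member meets at most one cylinder.\<close>

lemma card_admissible_words_le:
  assumes "compact (UNIV :: 'a set)"
  defines "\<A> \<equiv> range (\<lambda>z::'a. ball z (r / 2))"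
  shows "card (admissible_words A n) \<le>
    min_subcover_card (restrict_cover (cover_join f \<A> n) (coded_set 0)) (coded_set 0)"
proof (rule min_subcover_card_ge)
  have "\<Union>\<A> = UNIV" unfolding \<A>_def using r_pos by (auto intro: centre_in_ball[THEN iffD2])
  then show "\<exists>\<D>\<subseteq>restrict_cover (cover_join f \<A> n) (coded_set 0). finite \<D> \<and> coded_set 0 \<subseteq> \<Union>\<D>"
    by (intro finite_subcover_cover_join assms(1)) (auto simp: \<A>_def)
next
  fix \<D> assume \<D>: "\<D> \<subseteq> restrict_cover (cover_join f \<A> n) (coded_set 0)"
    "finite \<D>" "coded_set 0 \<subseteq> \<Union>\<D>"
  \<comment> \<open>Every admissible word is read off some point because \<open>code 0\<close> is
    onto.\<close>
  have "admissible_words A n = (\<lambda>x. map (code 0 x) [0..<n]) ` coded_set 0"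
    unfolding admissible_words_def code_onto[of 0, symmetric] image_image ..
  also have "card \<dots> \<le> card \<D>"
  proof (rule card_image_le_card_cover[OF \<D>(2,3)])
    fix D x y assume D: "D \<in> \<D>" "x \<in> D" "y \<in> D"
    then obtain U where U: "D = (\<Inter>j<n. iter_comp f 0 j -` U j) \<inter> coded_set 0" "\<forall>j<n. U j \<in> \<A>"
      using \<D>(1) unfolding restrict_cover_def cover_join_def by blast
    have "code 0 x j = code 0 y j" if "j < n" for j
    proof (rule code_eq_if_close)
      have "U j \<in> \<A>" using U(2) that by blast
      then obtain z where "U j = ball z (r / 2)" unfolding \<A>_def by blast
      moreover have "iter_comp f 0 j x \<in> U j" "iter_comp f 0 j y \<in> U j"
        using D(2,3) that unfolding U(1) by auto
      ultimately have "dist z (iter_comp f 0 j x) < r / 2" "dist z (iter_comp f 0 j y) < r / 2"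
        by auto
      then show "dist (iter_comp f 0 j x) (iter_comp f 0 j y) < r"
        by (metis dist_commute dist_triangle_half_r)
    qed (use D U in auto)
    then show "map (code 0 x) [0..<n] = map (code 0 y) [0..<n]" by simp
  qed
  finally show "card (admissible_words A n) \<le> card \<D>" .
qed

text \<open>A single cover bounds the supremum from below. For the balls of radius
  \<open>r / 2\<close> the word count is a lower bound at every \<open>n\<close>, and its
  exponential rate is already known.\<close>

lemma top_entropy_ge:
  assumes "compact (UNIV :: 'a set)"
  shows "ereal (ln (growth_rate A)) \<le> top_entropy f (coded_set 0)"
proof -
  define \<A> where "\<A> = range (\<lambda>z::'a. ball z (r / 2))"
  define M where
    "M n = min_subcover_card (restrict_cover (cover_join f \<A> n) (coded_set 0)) (coded_set 0)" for n
  have cover: "(\<forall>U\<in>\<A>. open U) \<and> \<Union>\<A> = UNIV"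
    unfolding \<A>_def using r_pos by (auto intro: centre_in_ball[THEN iffD2])
  let ?w = "\<lambda>n. real (card (admissible_words A n))"
  have "(\<lambda>n. ln (?w n) / real n) \<longlonglongrightarrow> ln (growth_rate A)"
    using ln_card_admissible_words_tendsto by (rule LIMSEQ_imp_Suc)
  then have "limsup (\<lambda>n. ereal (ln (?w n) / real n)) = ereal (ln (growth_rate A))"
    by (intro lim_imp_Limsup tendsto_ereal) simp_all
  moreover have "ln (?w n) / real n \<le> 1 / real n * ln (real (M n))" for n
  proof -
    have "admissible_words A n \<noteq> {}" using ex_seq_from by (auto simp: admissible_words_def)
    then have "card (admissible_words A n) > 0" by (simp add: card_gt_0_iff finite_admissible_words)
    moreover have "card (admissible_words A n) \<le> M n"
      unfolding M_def \<A>_def by (rule card_admissible_words_le[OF assms])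
    ultimately have "ln (?w n) \<le> ln (real (M n))" by simp
    then show ?thesis by (simp add: divide_right_mono)
  qed
  ultimately have "ereal (ln (growth_rate A)) \<le> limsup (\<lambda>n. ereal (1 / real n * ln (real (M n))))"
    by (metis (no_types, lifting) Limsup_mono always_eventually ereal_less_eq(3))
  then show ?thesis
    unfolding top_entropy_def M_def using cover by (intro SUP_upper2[of \<A>]) auto
qed

end

theorem theorem3p4:
  fixes f :: "nat \<Rightarrow> 'a::metric_space \<Rightarrow> 'a"
    and A :: "real^'n^'n"
    and V :: "'n \<Rightarrow> 'a set"
    and W :: "'n \<Rightarrow> nat \<Rightarrow> 'a set"
  assumes "transition_matrix A"
    and "\<And>i. V i \<noteq> {}"
    and "\<And>i j. i \<noteq> j \<Longrightarrow> setdist (V i) (V j) > 0"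
    and "\<And>i n. W i n \<noteq> {}"
    and "\<And>i n. compact (W i n)"
    and "\<And>i n. W i n \<subseteq> V i"
    and "equi_continuous_in dist f (\<lambda>_. \<Union>n. \<Union>i. W i n)"
    and "weakly_coupled_expanding A f W"
  shows "\<exists>\<Lambda>. (\<forall>n. \<Lambda> n \<noteq> {} \<and> compact (\<Lambda> n) \<and> \<Lambda> n \<subseteq> (\<Union>i. W i n) \<and> f n ` \<Lambda> n = \<Lambda> (Suc n)) \<and>
             equi_semiconjugate_to_shift f \<Lambda> A \<and>
             (compact (UNIV :: 'a set) \<longrightarrow> top_entropy f (\<Lambda> 0) \<ge> ereal (ln (growth_rate A)))"
proof -
  \<comment> \<open>With finitely many symbols the minimum of \<open>S\<close> is a positive
    separation constant for all pairs; the element 1 makes \<open>S\<close> visibly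
    nonempty.\<close>
  define S where "S = insert 1 ((\<lambda>(i, j). setdist (V i) (V j)) ` {(i, j). i \<noteq> j})"
  have S: "finite S" "S \<noteq> {}" "\<And>r. r \<in> S \<Longrightarrow> r > 0"
    using assms(3) by (auto simp: S_def)
  have Min_le: "Min S \<le> setdist (V i) (V j)" if "i \<noteq> j" for i j
    using S(1) that by (intro Min_le) (auto simp: S_def)
  interpret separated_expanding A f W "Min S"
  proof unfold_locales
    show "Min S > 0" using S by (simp add: Min_gr_iff)
    fix i j m n x y assume "i \<noteq> j" "x \<in> W i m" "y \<in> W j n"
    then show "Min S \<le> dist x y"
      using Min_le[of i j] setdist_le_dist[of x "V i" y "V j"] assms(6) by fastforce
  qed (use assms in auto)
  show ?thesis
    by (intro exI[where x = coded_set] conjI allI impI coded_set_nonempty compact_coded_set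
        coded_set_subset image_coded_set equi_semiconjugate_coded_set top_entropy_ge)
qed

end
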